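(* Let $S$ be a semitopological monoid in which all left shifts are open maps or all right shifts are open maps. Let $\sim$ be the smallest closed congruence on $S$. Then $\mathcal{C}_2(S)=S/\sim$; that is, $S/\sim$ with the quotient topology, together with the quotient map $S\to S/\sim$, is the $T_2$-reflection of $S$.
   Context: A semitopological monoid is a monoid $S$ with a topology (no separation axiom assumed) such that for every $a\in S$ the left shift $l_a\colon x\mapsto ax$ and the right shift $r_a\colon x\mapsto xa$ are continuous maps $S\to S$. Left (right) shifts are open if $l_a(U)$ (resp. $r_a(U)$) is open in $S$ for every $a\in S$ and every open $U\subseteq S$. A congruence on $S$ is an equivalence relation $\sim$ such that $x\sim y$ and $a\sim b$ imply $xa\sim yb$; it is closed if it is a closed subset of $S\times S$. "Smallest" is with respect to inclusion (the intersection of all closed congruences). The class $\mathcal{C}_2$ of $T_2$ (Hausdorff) spaces is epireflective in the category of topological spaces: for each space $X$ there is a Hausdorff space $\mathcal{C}_2(X)$ and a continuous surjection $\varphi\colon X\to\mathcal{C}_2(X)$ such that every continuous map $f\colon X\to Y$ with $Y$ Hausdorff factors as $f=g\circ\varphi$ for a unique continuous $g\colon\mathcal{C}_2(X)\to Y$. The pair is unique up to canonical homeomorphism and is called the $T_2$-reflection of $X$; equality is understood in this sense. *)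

theory Defs
  imports "HOL-Analysis.Analysis" "HOL-Algebra.Group"
begin

locale semitopological_monoid = monoid S
  for S :: "('a, 'm) monoid_scheme" (structure) +
  fixes T :: "'a topology"
  assumes topspace_carrier: "topspace T = carrier S"
    and left_shift_continuous: "a \<in> carrier S \<Longrightarrow> continuous_map T T (\<lambda>x. a \<otimes> x)"
    and right_shift_continuous: "a \<in> carrier S \<Longrightarrow> continuous_map T T (\<lambda>x. x \<otimes> a)"

definition open_left_shifts :: "('a, 'm) monoid_scheme \<Rightarrow> 'a topology \<Rightarrow> bool" where
  "open_left_shifts S T \<longleftrightarrow> (\<forall>a\<in>carrier S. open_map T T (\<lambda>x. a \<otimes>\<^bsub>S\<^esub> x))"

definition open_right_shifts :: "('a, 'm) monoid_scheme \<Rightarrow> 'a topology \<Rightarrow> bool" where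
  "open_right_shifts S T \<longleftrightarrow> (\<forall>a\<in>carrier S. open_map T T (\<lambda>x. x \<otimes>\<^bsub>S\<^esub> a))"

definition monoid_congruence :: "('a, 'm) monoid_scheme \<Rightarrow> ('a \<times> 'a) set \<Rightarrow> bool" where
  "monoid_congruence S r \<longleftrightarrow> equiv (carrier S) r \<and>
    (\<forall>x y a b. (x, y) \<in> r \<longrightarrow> (a, b) \<in> r \<longrightarrow> (x \<otimes>\<^bsub>S\<^esub> a, y \<otimes>\<^bsub>S\<^esub> b) \<in> r)"

definition closed_congruence ::
  "('a, 'm) monoid_scheme \<Rightarrow> 'a topology \<Rightarrow> ('a \<times> 'a) set \<Rightarrow> bool" where
  "closed_congruence S T r \<longleftrightarrow> monoid_congruence S r \<and> closedin (prod_topology T T) r"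

definition smallest_closed_congruence ::
  "('a, 'm) monoid_scheme \<Rightarrow> 'a topology \<Rightarrow> ('a \<times> 'a) set" where
  "smallest_closed_congruence S T = \<Inter>{r. closed_congruence S T r}"

lemma monoid_congruence_full:
  assumes "monoid S"
  shows "monoid_congruence S (carrier S \<times> carrier S)"
proof -
  interpret monoid S by (fact assms)
  show ?thesis
    unfolding monoid_congruence_def equiv_def refl_on_def sym_def trans_def by simp
qed

lemma closed_congruence_smallest:
  assumes "semitopological_monoid S T"
  shows "closed_congruence S T (smallest_closed_congruence S T)"
proof -
  interpret semitopological_monoid S T by (fact assms)
  have full: "closed_congruence S T (carrier S \<times> carrier S)"
    using monoid_congruence_full[OF monoid_axioms] topspace_carrier
      closedin_topspace[of "prod_topology T T"]
    by (simp add: closed_congruence_def)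
  have sub: "smallest_closed_congruence S T \<subseteq> carrier S \<times> carrier S"
    using full by (auto simp: smallest_closed_congruence_def)
  have cc: "r \<subseteq> carrier S \<times> carrier S" "refl_on (carrier S) r" "sym r" "trans r"
    "\<And>x y a b. (x, y) \<in> r \<Longrightarrow> (a, b) \<in> r \<Longrightarrow> (x \<otimes>\<^bsub>S\<^esub> a, y \<otimes>\<^bsub>S\<^esub> b) \<in> r" "closedin (prod_topology T T) r"
    if "closed_congruence S T r" for r
    using that unfolding closed_congruence_def monoid_congruence_def equiv_def by blast+
  have mem: "p \<in> smallest_closed_congruence S T \<longleftrightarrow> (\<forall>r. closed_congruence S T r \<longrightarrow> p \<in> r)" for p
    by (simp add: smallest_closed_congruence_def)
  have "equiv (carrier S) (smallest_closed_congruence S T)"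
  proof (rule equivI)
    show "smallest_closed_congruence S T \<subseteq> carrier S \<times> carrier S" by (fact sub)
    show "refl_on (carrier S) (smallest_closed_congruence S T)"
      by (rule refl_onI) (simp add: mem cc(2)[THEN refl_onD])
    show "sym (smallest_closed_congruence S T)"
      by (rule symI) (simp add: mem cc(3)[THEN symD])
    show "trans (smallest_closed_congruence S T)"
      by (rule transI) (unfold mem, meson cc(4) transD)
  qed
  moreover have "(x \<otimes>\<^bsub>S\<^esub> a, y \<otimes>\<^bsub>S\<^esub> b) \<in> smallest_closed_congruence S T"
    if "(x, y) \<in> smallest_closed_congruence S T" "(a, b) \<in> smallest_closed_congruence S T" for x y a b
    using that cc(5) unfolding mem by simp
  moreover have "closedin (prod_topology T T) (smallest_closed_congruence S T)"
    unfolding smallest_closed_congruence_def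
    by (rule closedin_Inter) (use full cc(6) in auto)
  ultimately show ?thesis
    by (simp add: closed_congruence_def monoid_congruence_def)
qed

lemma smallest_closed_congruence_least:
  "closed_congruence S T r \<Longrightarrow> smallest_closed_congruence S T \<subseteq> r"
  by (auto simp: smallest_closed_congruence_def)

definition quotient_proj :: "('a \<times> 'a) set \<Rightarrow> 'a \<Rightarrow> 'a set" where
  "quotient_proj r x = r `` {x}"

definition quotient_topology :: "'a topology \<Rightarrow> ('a \<times> 'a) set \<Rightarrow> 'a set topology" where
  "quotient_topology T r = topology (\<lambda>U. U \<subseteq> topspace T // r \<and>
    openin T {x \<in> topspace T. quotient_proj r x \<in> U})"

lemma openin_quotient_topology:
  "openin (quotient_topology T r) U \<longleftrightarrow>
    U \<subseteq> topspace T // r \<and> openin T {x \<in> topspace T. quotient_proj r x \<in> U}"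
proof -
  let ?P = "\<lambda>U. {x \<in> topspace T. quotient_proj r x \<in> U}"
  have 1: "?P (U \<inter> V) = ?P U \<inter> ?P V" for U V by auto
  have 2: "?P (\<Union>K) = (\<Union>U\<in>K. ?P U)" for K by auto
  have "istopology (\<lambda>U. U \<subseteq> topspace T // r \<and> openin T (?P U))"
    unfolding istopology_def 1 2 by auto
  then show ?thesis
    unfolding quotient_topology_def by (simp add: topology_inverse')
qed

lemma topspace_quotient_topology: "topspace (quotient_topology T r) = topspace T // r"
proof -
  have "{x \<in> topspace T. quotient_proj r x \<in> topspace T // r} = topspace T"
    by (auto simp: quotient_proj_def quotient_def)
  then have "openin (quotient_topology T r) (topspace T // r)"
    by (simp add: openin_quotient_topology)
  then show ?thesis
    using openin_quotient_topology[of T r "topspace (quotient_topology T r)"] openin_subset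
    by (intro subset_antisym) auto
qed

lemma quotient_map_quotient_proj: "quotient_map T (quotient_topology T r) (quotient_proj r)"
  unfolding quotient_map_def topspace_quotient_topology
  by (auto simp: openin_quotient_topology quotient_proj_def quotient_def)

text \<open>The universal property quantifies over spaces carried by subsets of an arbitrary type
  \<^typ>\<open>'y\<close>; leaving \<^typ>\<open>'y\<close> free in a theorem yields it for all Hausdorff spaces.
  As functions are total, uniqueness of the factor \<open>g\<close> is meant up to its values outside the
  domain, which is what \<^const>\<open>extensional\<close> expresses.\<close>

definition T2_reflection ::
  "'y itself \<Rightarrow> 'x topology \<Rightarrow> 'q topology \<Rightarrow> ('x \<Rightarrow> 'q) \<Rightarrow> bool" where
  "T2_reflection _ X Q \<phi> \<longleftrightarrow>
    Hausdorff_space Q \<and> continuous_map X Q \<phi> \<and> \<phi> ` topspace X = topspace Q \<and>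
    (\<forall>(Y :: 'y topology) f. Hausdorff_space Y \<and> continuous_map X Y f \<longrightarrow>
      (\<exists>!g. g \<in> extensional (topspace Q) \<and> continuous_map Q Y g \<and>
        (\<forall>x\<in>topspace X. f x = g (\<phi> x))))"

end

theory Submission
  imports Defs
begin

text \<open>Continuous maps into Hausdorff spaces respect the smallest closed congruence because
  \<open>f (a x b) = f (a y b)\<close> for all \<open>a, b\<close> defines a closed congruence. If the left shifts are
  open, then \<open>w V\<close>, for \<open>V\<close> an open neighbourhood of the identity, is a neighbourhood base
  at \<open>w\<close>; from \<open>x \<sim> w\<close> it follows that \<open>x V\<close> lies in the saturation of \<open>w V\<close>, so the quotient
  map of any congruence is open, and an open quotient by a closed relation is Hausdorff.\<close>

lemma quotient_proj_eq_iff: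
  assumes "equiv A r" "x \<in> A" "y \<in> A"
  shows "quotient_proj r x = quotient_proj r y \<longleftrightarrow> (x, y) \<in> r"
  unfolding quotient_proj_def using assms by (rule eq_equiv_class_iff)

text \<open>Here \<open>p a x\<close> stands for the product of \<open>a\<close> and
  \<open>x\<close> in either order, so that one argument serves open left shifts and open right
  shifts alike.\<close>

lemma open_map_quotient_proj:
  fixes T :: "'a topology" and p :: "'a \<Rightarrow> 'a \<Rightarrow> 'a"
  assumes equiv: "equiv (topspace T) r"
    and unit: "e \<in> topspace T" "\<And>a. a \<in> topspace T \<Longrightarrow> p a e = a"
    and cont: "\<And>a. a \<in> topspace T \<Longrightarrow> continuous_map T T (p a)"
    and "open": "\<And>a. a \<in> topspace T \<Longrightarrow> open_map T T (p a)"
    and compat: "\<And>x y v. (x, y) \<in> r \<Longrightarrow> v \<in> topspace T \<Longrightarrow> (p x v, p y v) \<in> r"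
  shows "open_map T (quotient_topology T r) (quotient_proj r)"
  unfolding open_map_def
proof (intro allI impI)
  fix W assume W: "openin T W"
  have WT: "W \<subseteq> topspace T" using W by (rule openin_subset)
  \<comment> \<open>The saturation of \<open>W\<close>: the image of \<open>W\<close> is open in the
    quotient exactly when this set is open in \<open>T\<close>.\<close>
  let ?sat = "{x \<in> topspace T. quotient_proj r x \<in> quotient_proj r ` W}"
  have "\<exists>N. openin T N \<and> x \<in> N \<and> N \<subseteq> ?sat" if sat: "x \<in> ?sat" for x
  proof -
    obtain w where w: "w \<in> W" "quotient_proj r x = quotient_proj r w" and x: "x \<in> topspace T"
      using sat by auto
    have wT: "w \<in> topspace T" using w WT by auto
    have xw: "(x, w) \<in> r" using w(2) quotient_proj_eq_iff[OF equiv x wT] by simp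
    \<comment> \<open>This set contains \<open>e\<close> because \<open>p w e = w\<close> lies in
      \<open>W\<close>. Hence \<open>p x\<close> carries it to an open set containing
      \<open>p x e = x\<close>.\<close>
    define V where "V = {v \<in> topspace T. p w v \<in> W}"
    have V: "openin T V" unfolding V_def
      using cont[OF wT] W by (rule openin_continuous_map_preimage)
    have "openin T (p x ` V)" using "open"[OF x] V by (auto simp: open_map_def)
    moreover have "x \<in> p x ` V"
      using unit x wT w(1) by (intro image_eqI[of _ _ e]) (auto simp: V_def)
    moreover have "p x ` V \<subseteq> ?sat"
    proof clarify
      fix v assume v: "v \<in> V"
      have "(p x v, p w v) \<in> r" using compat xw v by (simp add: V_def)
      moreover have "p x v \<in> topspace T" "p w v \<in> topspace T"
        using calculation equiv by (auto simp: equiv_def)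
      ultimately show "p x v \<in> topspace T \<and> quotient_proj r (p x v) \<in> quotient_proj r ` W"
        using quotient_proj_eq_iff[OF equiv] v by (auto simp: V_def)
    qed
    ultimately show ?thesis by blast
  qed
  then have "openin T ?sat" by (subst openin_subopen) blast
  then show "openin (quotient_topology T r) (quotient_proj r ` W)"
    using WT by (auto simp: openin_quotient_topology quotient_proj_def intro: quotientI)
qed

text \<open>A pair of unrelated points lies in the open complement of \<open>r\<close>, hence in an
  open box \<open>U \<times> V\<close> missing \<open>r\<close>. No point of \<open>U\<close> is
  related to a point of \<open>V\<close>, so the images of \<open>U\<close> and \<open>V\<close> are
  disjoint, and they are open since the projection is.\<close>

lemma Hausdorff_space_open_quotient:
  assumes equiv: "equiv (topspace T) r"
    and closed: "closedin (prod_topology T T) r"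
    and "open": "open_map T (quotient_topology T r) (quotient_proj r)"
  shows "Hausdorff_space (quotient_topology T r)"
  unfolding Hausdorff_space_def topspace_quotient_topology
proof clarify
  fix P Q assume PQ: "P \<in> topspace T // r" "Q \<in> topspace T // r" "P \<noteq> Q"
  obtain x y where x: "x \<in> topspace T" "P = quotient_proj r x"
    and y: "y \<in> topspace T" "Q = quotient_proj r y"
    using PQ by (auto simp: quotient_proj_def elim!: quotientE)
  have xy: "(x, y) \<in> topspace (prod_topology T T) - r"
    using x y PQ(3) quotient_proj_eq_iff[OF equiv x(1) y(1)] by simp
  have "openin (prod_topology T T) (topspace (prod_topology T T) - r)"
    using closed by blast
  from openin_prod_topology_alt[THEN iffD1, OF this, rule_format, OF xy]
  obtain U V where UV: "openin T U" "openin T V" "x \<in> U" "y \<in> V"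
    and disj: "U \<times> V \<subseteq> topspace (prod_topology T T) - r"
    by blast
  have "disjnt (quotient_proj r ` U) (quotient_proj r ` V)"
  proof -
    have "quotient_proj r u \<noteq> quotient_proj r v" if "u \<in> U" "v \<in> V" for u v
    proof -
      have "u \<in> topspace T" "v \<in> topspace T"
        using that UV(1,2) openin_subset by blast+
      moreover have "(u, v) \<notin> r" using disj that by blast
      ultimately show ?thesis by (simp add: quotient_proj_eq_iff[OF equiv])
    qed
    then show ?thesis by (auto simp: disjnt_iff)
  qed
  moreover have "openin (quotient_topology T r) (quotient_proj r ` U)"
    "openin (quotient_topology T r) (quotient_proj r ` V)"
    using "open" UV by (auto simp: open_map_def)
  ultimately show "\<exists>U V. openin (quotient_topology T r) U \<and> openin (quotient_topology T r) V \<and>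
      P \<in> U \<and> Q \<in> V \<and> disjnt U V"
    using x(2) y(2) UV by blast
qed

context semitopological_monoid
begin

lemma Hausdorff_space_quotient:
  assumes r: "closed_congruence S T r"
    and "open": "open_left_shifts S T \<or> open_right_shifts S T"
  shows "Hausdorff_space (quotient_topology T r)"
proof (rule Hausdorff_space_open_quotient)
  show equiv: "equiv (topspace T) r" and "closedin (prod_topology T T) r"
    using r by (simp_all add: closed_congruence_def monoid_congruence_def topspace_carrier)
  have mult: "(x \<otimes> a, y \<otimes> b) \<in> r" if "(x, y) \<in> r" "(a, b) \<in> r" for x y a b
    using r that by (auto simp: closed_congruence_def monoid_congruence_def)
  \<comment> \<open>Multiplying a related pair by \<open>(v, v)\<close> gives the one-sided
    compatibility that \<open>open_map_quotient_proj\<close> asks for.\<close>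
  have rfl: "(x, x) \<in> r" if "x \<in> topspace T" for x
    using equiv that by (meson equiv_def refl_onD)
  from "open" show "open_map T (quotient_topology T r) (quotient_proj r)"
  proof
    assume "open_left_shifts S T"
    then show ?thesis
      using equiv left_shift_continuous mult rfl
      by (intro open_map_quotient_proj[where p = "\<lambda>a x. a \<otimes> x" and e = \<one>])
        (auto simp: open_left_shifts_def topspace_carrier)
  next
    assume "open_right_shifts S T"
    then show ?thesis
      using equiv right_shift_continuous mult rfl
      by (intro open_map_quotient_proj[where p = "\<lambda>a x. x \<otimes> a" and e = \<one>])
        (auto simp: open_right_shifts_def topspace_carrier)
  qed
qed

text \<open>The kernel of \<open>f\<close> is a closed equivalence but need not respect products.
  Quantifying over two-sided translates gives the largest congruence inside that kernel, and it
  stays closed as an intersection of equalizers of continuous maps into a Hausdorff space.\<close>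

lemma closed_congruence_of_continuous_map:
  assumes Y: "Hausdorff_space Y" and f: "continuous_map T Y f"
  shows "closed_congruence S T {(x, y). x \<in> carrier S \<and> y \<in> carrier S \<and>
    (\<forall>a\<in>carrier S. \<forall>b\<in>carrier S. f (a \<otimes> x \<otimes> b) = f (a \<otimes> y \<otimes> b))}"
    (is "closed_congruence S T ?r")
proof -
  let ?h = "\<lambda>a b x. f (a \<otimes> x \<otimes> b)"
  have "continuous_map T Y (?h a b)" if "a \<in> carrier S" "b \<in> carrier S" for a b
    using continuous_map_compose[OF continuous_map_compose[OF left_shift_continuous[OF that(1)]
        right_shift_continuous[OF that(2)]] f]
    by (simp add: o_def)
  then have "closedin (prod_topology T T)
      {z \<in> topspace (prod_topology T T). (?h a b \<circ> fst) z = (?h a b \<circ> snd) z}"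
    if "a \<in> carrier S" "b \<in> carrier S" for a b
    using that
    by (intro closedin_continuous_maps_eq[OF Y] continuous_map_compose[of _ T]
        continuous_map_fst continuous_map_snd)
  then have "closedin (prod_topology T T) (\<Inter>a\<in>carrier S. \<Inter>b\<in>carrier S.
      {z \<in> topspace (prod_topology T T). (?h a b \<circ> fst) z = (?h a b \<circ> snd) z})"
    by (intro closedin_INT) auto
  \<comment> \<open>The unit makes the index sets nonempty, which confines the intersection to pairs
    from the carrier.\<close>
  also have "(\<Inter>a\<in>carrier S. \<Inter>b\<in>carrier S.
      {z \<in> topspace (prod_topology T T). (?h a b \<circ> fst) z = (?h a b \<circ> snd) z}) = ?r"
    using one_closed by (auto simp: topspace_carrier)
  finally have "closedin (prod_topology T T) ?r" .
  moreover have "equiv (carrier S) ?r"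
    by (intro equivI refl_onI symI transI) auto
  moreover have "(x \<otimes> c, y \<otimes> d) \<in> ?r" if xy: "(x, y) \<in> ?r" and cd: "(c, d) \<in> ?r" for x y c d
  proof -
    have "f (a \<otimes> (x \<otimes> c) \<otimes> b) = f (a \<otimes> (y \<otimes> d) \<otimes> b)"
      if ab: "a \<in> carrier S" "b \<in> carrier S" for a b
    proof -
      \<comment> \<open>One factor is exchanged at a time: with \<open>c \<otimes> b\<close> as
        right multiplier \<open>x\<close> becomes \<open>y\<close>, then with
        \<open>a \<otimes> y\<close> as left multiplier \<open>c\<close> becomes
        \<open>d\<close>.\<close>
      have "f (a \<otimes> (x \<otimes> c) \<otimes> b) = f (a \<otimes> x \<otimes> (c \<otimes> b))" using xy cd ab by (simp add: m_assoc)
      also have "\<dots> = f (a \<otimes> y \<otimes> (c \<otimes> b))" using xy cd ab by auto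
      also have "\<dots> = f ((a \<otimes> y) \<otimes> c \<otimes> b)" using xy cd ab by (simp add: m_assoc)
      also have "\<dots> = f ((a \<otimes> y) \<otimes> d \<otimes> b)"
        using xy cd ab by (metis (mono_tags, lifting) case_prodD m_closed mem_Collect_eq)
      also have "\<dots> = f (a \<otimes> (y \<otimes> d) \<otimes> b)" using xy cd ab by (simp add: m_assoc)
      finally show ?thesis .
    qed
    then show ?thesis using xy cd by simp
  qed
  ultimately show ?thesis
    unfolding closed_congruence_def monoid_congruence_def by blast
qed

text \<open>By minimality the pair lies in the closed congruence attached to \<open>f\<close>;
  taking both multipliers to be the unit gives the equality. This is what lets \<open>f\<close>
  descend to the quotient.\<close>

lemma continuous_map_respects_smallest_closed_congruence:
  assumes "Hausdorff_space Y" "continuous_map T Y f"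
    and "(x, y) \<in> smallest_closed_congruence S T"
  shows "f x = f y"
proof -
  have *: "x \<in> carrier S \<and> y \<in> carrier S \<and>
      (\<forall>a\<in>carrier S. \<forall>b\<in>carrier S. f (a \<otimes> x \<otimes> b) = f (a \<otimes> y \<otimes> b))"
    using subsetD[OF smallest_closed_congruence_least assms(3),
        OF closed_congruence_of_continuous_map[OF assms(1,2)]]
    by simp
  then have "f (\<one> \<otimes> x \<otimes> \<one>) = f (\<one> \<otimes> y \<otimes> \<one>)" using one_closed by blast
  with * show ?thesis by simp
qed

end

theorem theorem2p5:
  fixes S :: "('a, 'm) monoid_scheme" and T :: "'a topology"
  assumes "semitopological_monoid S T"
    and "open_left_shifts S T \<or> open_right_shifts S T"
  shows "T2_reflection TYPE('y) T
    (quotient_topology T (smallest_closed_congruence S T))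
    (quotient_proj (smallest_closed_congruence S T))"
proof -
  interpret semitopological_monoid S T by (fact assms(1))
  define r where "r = smallest_closed_congruence S T"
  let ?Q = "quotient_topology T r" and ?q = "quotient_proj r"
  have r: "closed_congruence S T r"
    unfolding r_def using assms(1) by (rule closed_congruence_smallest)
  then have equiv: "equiv (topspace T) r"
    by (simp add: closed_congruence_def monoid_congruence_def topspace_carrier)
  have quot: "quotient_map T ?Q ?q" by (rule quotient_map_quotient_proj)
  then have surj: "?q ` topspace T = topspace ?Q" by (rule quotient_imp_surjective_map)
  have "\<exists>!g. g \<in> extensional (topspace ?Q) \<and> continuous_map ?Q Y g \<and>
      (\<forall>x\<in>topspace T. f x = g (?q x))"
    if Y: "Hausdorff_space Y" and f: "continuous_map T Y f" for Y :: "'y topology" and f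
  proof -
    have "f x = f y" if "x \<in> topspace T" "y \<in> topspace T" "?q x = ?q y" for x y
      using that quotient_proj_eq_iff[OF equiv]
        continuous_map_respects_smallest_closed_congruence[OF Y f] by (simp add: r_def)
    then obtain g where g: "continuous_map ?Q Y g" "\<And>x. x \<in> topspace T \<Longrightarrow> g (?q x) = f x"
      using quotient_map_lift_exists[OF quot f] by metis
    show ?thesis
    proof (rule ex1I)
      \<comment> \<open>The lift \<open>g\<close> is arbitrary off \<open>topspace ?Q\<close>;
        restricting it fixes the value \<open>undefined\<close> there.\<close>
      show "restrict g (topspace ?Q) \<in> extensional (topspace ?Q) \<and>
          continuous_map ?Q Y (restrict g (topspace ?Q)) \<and>
          (\<forall>x\<in>topspace T. f x = restrict g (topspace ?Q) (?q x))"
      proof (intro conjI ballI)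
        show "continuous_map ?Q Y (restrict g (topspace ?Q))"
          using g(1) by (rule continuous_map_eq) simp
        fix x assume x: "x \<in> topspace T"
        then have "?q x \<in> topspace ?Q" using surj by blast
        then show "f x = restrict g (topspace ?Q) (?q x)" using g(2)[OF x] by simp
      qed simp
    next
      fix h assume h: "h \<in> extensional (topspace ?Q) \<and> continuous_map ?Q Y h \<and>
        (\<forall>x\<in>topspace T. f x = h (?q x))"
      show "h = restrict g (topspace ?Q)"
      proof (rule extensionalityI[of _ "topspace ?Q"])
        fix c assume c: "c \<in> topspace ?Q"
        \<comment> \<open>Every point of the quotient is a class \<open>?q x\<close>, where
          \<open>h\<close> and \<open>g\<close> must both take the value \<open>f x\<close>.\<close>
        then obtain x where "x \<in> topspace T" "c = ?q x" using surj by blast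
        then show "h c = restrict g (topspace ?Q) c" using h g(2) c by auto
      qed (use h in auto)
    qed
  qed
  then show ?thesis
    unfolding T2_reflection_def r_def[symmetric]
    using Hausdorff_space_quotient[OF r assms(2)] quotient_imp_continuous_map[OF quot] surj
    by (intro conjI allI impI) simp_all
qed

end
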